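(* A set $A\subseteq\mathbb{N}$ is $D$-w.e.u. if and only if it is $wtt$-complete.
   Context: $\varphi_0,\varphi_1,\ldots$ is a standard acceptable enumeration of the partial computable functions $\mathbb{N}\to\mathbb{N}$; $\varphi_e^A$ denotes the $e$th partial function computable with oracle $A$; $\mathcal{K}=\{e:\varphi_e(e)\text{ defined}\}$; $\mathbb{1}_A$ the characteristic function of $A$. $\mathfrak{P}_{\mathrm{fin}}(\mathbb{N})$ is the set of finite subsets of $\mathbb{N}$; $f\colon\mathbb{N}\to\mathfrak{P}_{\mathrm{fin}}(\mathbb{N})$ is computable if $e\mapsto$ (canonical index of $f(e)$) is computable. A recursively enumerable $A$ is $D$-w.e.u. if there is a computable $f\colon\mathbb{N}\to\mathfrak{P}_{\mathrm{fin}}(\mathbb{N})$ such that for all $e$: if $\varphi_e(z)$ is defined for all $z\in f(e)$, then there is $z\in f(e)$ with $\varphi_e(z)\neq\mathbb{1}_A(z)$. A recursively enumerable $A$ is $wtt$-complete if there are an index $e$ and a total computable $f\colon\mathbb{N}\to\mathbb{N}$ such that $\mathbb{1}_{\mathcal{K}}=\varphi_e^A$ and for every $x$ the computation of $\varphi_e^A(x)$ queries the oracle only about numbers below $f(x)$. *)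

theory Defs
  imports Main "HOL-Library.Nat_Bijection"
begin

text \<open>Unary partial recursive functions on nat, with Cantor pairing (prod_encode)
  for multiple arguments, plus an oracle primitive.  This is Kleene's
  mu-recursive basis: constants/successor/projections, composition, pairing,
  primitive recursion, unbounded minimisation, and oracle queries.\<close>

datatype rf =
    Zero | Succ | Ident | Fst | Snd | Orc
  | Comp rf rf
  | Pair rf rf
  | PrimRec rf rf
  | Mu rf

text \<open>evalq A t x y Q: with oracle A, program t on input x halts with output y,
  and Q is the set of numbers about which the oracle was queried.\<close>

inductive evalq :: "nat set \<Rightarrow> rf \<Rightarrow> nat \<Rightarrow> nat \<Rightarrow> nat set \<Rightarrow> bool" for A where
  ev_zero: "evalq A Zero x 0 {}"
| ev_succ: "evalq A Succ x (Suc x) {}"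
| ev_ident: "evalq A Ident x x {}"
| ev_fst: "evalq A Fst x (fst (prod_decode x)) {}"
| ev_snd: "evalq A Snd x (snd (prod_decode x)) {}"
| ev_orc: "evalq A Orc x (if x \<in> A then 1 else 0) {x}"
| ev_comp: "evalq A g x y Q1 \<Longrightarrow> evalq A f y z Q2 \<Longrightarrow> evalq A (Comp f g) x z (Q1 \<union> Q2)"
| ev_pair: "evalq A f x y1 Q1 \<Longrightarrow> evalq A g x y2 Q2 \<Longrightarrow>
            evalq A (Pair f g) x (prod_encode (y1, y2)) (Q1 \<union> Q2)"
| ev_pr0: "evalq A f a y Q \<Longrightarrow> evalq A (PrimRec f g) (prod_encode (a, 0)) y Q"
| ev_prS: "evalq A (PrimRec f g) (prod_encode (a, n)) y Q1 \<Longrightarrow>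
           evalq A g (prod_encode (a, prod_encode (n, y))) z Q2 \<Longrightarrow>
           evalq A (PrimRec f g) (prod_encode (a, Suc n)) z (Q1 \<union> Q2)"
| ev_mu: "(\<forall>i<n. evalq A f (prod_encode (x, i)) (Suc (vs i)) (Qs i)) \<Longrightarrow>
          evalq A f (prod_encode (x, n)) 0 Q \<Longrightarrow>
          evalq A (Mu f) x n (Q \<union> (\<Union>i<n. Qs i))"

fun rf_encode :: "rf \<Rightarrow> nat" where
  "rf_encode Zero = prod_encode (0, 0)"
| "rf_encode Succ = prod_encode (1, 0)"
| "rf_encode Ident = prod_encode (2, 0)"
| "rf_encode Fst = prod_encode (3, 0)"
| "rf_encode Snd = prod_encode (4, 0)"
| "rf_encode Orc = prod_encode (5, 0)"
| "rf_encode (Comp f g) = prod_encode (6, prod_encode (rf_encode f, rf_encode g))"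
| "rf_encode (Pair f g) = prod_encode (7, prod_encode (rf_encode f, rf_encode g))"
| "rf_encode (PrimRec f g) = prod_encode (8, prod_encode (rf_encode f, rf_encode g))"
| "rf_encode (Mu f) = prod_encode (9, rf_encode f)"

definition rf_decode :: "nat \<Rightarrow> rf" where
  "rf_decode e = (if e \<in> range rf_encode then (SOME t. rf_encode t = e) else Zero)"

definition phi_oracle :: "nat set \<Rightarrow> nat \<Rightarrow> nat \<Rightarrow> nat option" where
  "phi_oracle A e x =
     (if \<exists>y Q. evalq A (rf_decode e) x y Q
      then Some (THE y. \<exists>Q. evalq A (rf_decode e) x y Q) else None)"

definition phi :: "nat \<Rightarrow> nat \<Rightarrow> nat option" where
  "phi e x = phi_oracle {} e x"

definition queries_below :: "nat set \<Rightarrow> nat \<Rightarrow> nat \<Rightarrow> nat \<Rightarrow> bool" where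
  "queries_below A e x u \<longleftrightarrow> (\<forall>y Q. evalq A (rf_decode e) x y Q \<longrightarrow> (\<forall>q\<in>Q. q < u))"

definition computable :: "(nat \<Rightarrow> nat) \<Rightarrow> bool" where
  "computable f \<longleftrightarrow> (\<exists>e. \<forall>x. phi e x = Some (f x))"

text \<open>f : N -> P_fin(N) computable: e |-> canonical index of f e is computable
  (set_decode is the canonical-index decoding, set_decode n = {x. odd (n div 2^x)}).\<close>
definition computable_fin :: "(nat \<Rightarrow> nat set) \<Rightarrow> bool" where
  "computable_fin f \<longleftrightarrow> (\<forall>e. finite (f e)) \<and> computable (\<lambda>e. set_encode (f e))"

definition rec_enum :: "nat set \<Rightarrow> bool" where
  "rec_enum A \<longleftrightarrow> (\<exists>e. \<forall>x. x \<in> A \<longleftrightarrow> phi e x \<noteq> None)"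

definition indic :: "nat set \<Rightarrow> nat \<Rightarrow> nat" where
  "indic A z = (if z \<in> A then 1 else 0)"

definition haltK :: "nat set" where
  "haltK = {e. phi e e \<noteq> None}"

definition D_weu :: "nat set \<Rightarrow> bool" where
  "D_weu A \<longleftrightarrow> rec_enum A \<and>
     (\<exists>f. computable_fin f \<and>
        (\<forall>e. (\<forall>z\<in>f e. phi e z \<noteq> None) \<longrightarrow> (\<exists>z\<in>f e. phi e z \<noteq> Some (indic A z))))"

definition wtt_complete :: "nat set \<Rightarrow> bool" where
  "wtt_complete A \<longleftrightarrow> rec_enum A \<and>
     (\<exists>e f. computable f \<and>
        (\<forall>x. phi_oracle A e x = Some (indic haltK x)) \<and>
        (\<forall>x. queries_below A e x (f x)))"

end

theory Submission
  imports Defs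
begin

text \<open>If \<open>A\<close> is wtt-complete via \<open>\<Gamma>\<close> with use bound \<open>u\<close>, let \<open>h e\<close> be a code of the program that
  runs \<open>\<Gamma>\<close> with its oracle replaced by program \<open>e\<close> and halts iff the result is 0. If \<open>\<phi>\<^sub>e\<close> agreed with
  \<open>A\<close> below \<open>u (h e)\<close>, then \<open>\<Gamma>\<close> would err at \<open>h e\<close>. The replacement is syntactic, so no universal
  program is needed here.

  Conversely, let \<open>f\<close> witness that \<open>A\<close> is D-w.e.u., and let \<open>g x\<close> be a code of the program that waits
  for \<open>x\<close> to enter \<open>\<K>\<close>, say at stage \<open>s\<close>, and then computes the characteristic function of
  the stage \<open>s\<close> approximation of \<open>A\<close>. If \<open>x\<close> enters \<open>\<K>\<close>, then \<open>A\<close> changes on \<open>f (g x)\<close> after that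
  stage. So \<open>x \<in> \<K>\<close> is decided at the first stage at which \<open>A\<close> is settled on \<open>f (g x)\<close>, and this
  stage is found by querying \<open>A\<close> below a computable bound for the elements of \<open>f (g x)\<close>.\<close>

section \<open>Evaluation\<close>

abbreviation npair :: "nat \<Rightarrow> nat \<Rightarrow> nat" where "npair a b \<equiv> prod_encode (a, b)"
abbreviation nfst :: "nat \<Rightarrow> nat" where "nfst p \<equiv> fst (prod_decode p)"
abbreviation nsnd :: "nat \<Rightarrow> nat" where "nsnd p \<equiv> snd (prod_decode p)"

inductive_cases evalq_ZeroE: "evalq A Zero x y Q"
inductive_cases evalq_SuccE: "evalq A Succ x y Q"
inductive_cases evalq_IdentE: "evalq A Ident x y Q"
inductive_cases evalq_FstE: "evalq A Fst x y Q"
inductive_cases evalq_SndE: "evalq A Snd x y Q"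
inductive_cases evalq_OrcE: "evalq A Orc x y Q"
inductive_cases evalq_CompE: "evalq A (Comp f g) x y Q"
inductive_cases evalq_PairE: "evalq A (Pair f g) x y Q"
inductive_cases evalq_PrimRecE: "evalq A (PrimRec f g) x y Q"
inductive_cases evalq_MuE: "evalq A (Mu f) x y Q"

text \<open>Uniqueness of the value justifies the \<open>THE\<close> in \<open>phi_oracle\<close>.
  Uniqueness of the query set turns \<open>queries_below\<close> into a property of any one
  exhibited run.\<close>

lemma evalq_deterministic:
  assumes "evalq A t x y Q" "evalq A t x y' Q'"
  shows "y' = y \<and> Q' = Q"
  using assms
proof (induction arbitrary: y' Q' rule: evalq.induct)
  case (ev_comp g x y Q1 f z Q2)
  from ev_comp.prems show ?case
    by (rule evalq_CompE) (use ev_comp.IH in blast)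
next
  case (ev_pair f x y1 Q1 g y2 Q2)
  from ev_pair.prems show ?case
    by (rule evalq_PairE) (use ev_pair.IH in blast)
next
  case (ev_pr0 f a y Q g)
  from ev_pr0.prems show ?case
    by (rule evalq_PrimRecE) (use ev_pr0.IH in auto)
next
  case (ev_prS f g a n y Q1 z Q2)
  from ev_prS.prems show ?case
  proof (rule evalq_PrimRecE)
    fix a' n' y'' Q1' Q2'
    assume "npair a (Suc n) = npair a' (Suc n')" "Q' = Q1' \<union> Q2'"
      "evalq A (PrimRec f g) (npair a' n') y'' Q1'"
      "evalq A g (npair a' (npair n' y'')) y' Q2'"
    then show ?thesis using ev_prS.IH by auto
  qed simp
next
  case (ev_mu n f x vs Qs Q)
  from ev_mu.prems show ?case
  proof (rule evalq_MuE)
    fix vs' Qs' R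
    assume Q': "Q' = R \<union> (\<Union>i<y'. Qs' i)"
      and pos: "\<forall>i<y'. evalq A f (npair x i) (Suc (vs' i)) (Qs' i)"
      and zero: "evalq A f (npair x y') 0 R"
    \<comment> \<open>Whichever search stopped first would return 0 at an index where the other run
      has a positive value.\<close>
    have "\<not> y' < n" using ev_mu.IH(1) zero by blast
    moreover have "\<not> n < y'" using ev_mu.IH(2) pos by (metis nat.distinct(1))
    ultimately have "y' = n" by simp
    moreover have "R = Q" using zero ev_mu.IH(2) calculation by blast
    moreover have "Qs' i = Qs i" if "i < n" for i
      using pos ev_mu.IH(1) that \<open>y' = n\<close> by blast
    ultimately show ?thesis using Q' by simp
  qed
qed (auto elim: evalq_ZeroE evalq_SuccE evalq_IdentE evalq_FstE evalq_SndE evalq_OrcE)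

section \<open>Codes of programs and the partial functions they compute\<close>

lemma rf_encode_inject: "rf_encode s = rf_encode t \<longleftrightarrow> s = t"
proof (induction s arbitrary: t)
qed (case_tac t; auto)+

lemma rf_decode_encode [simp]: "rf_decode (rf_encode t) = t"
  by (simp add: rf_decode_def rf_encode_inject)

lemma phi_oracle_eq_Some:
  "phi_oracle A e x = Some y \<longleftrightarrow> (\<exists>Q. evalq A (rf_decode e) x y Q)"
proof
  assume "\<exists>Q. evalq A (rf_decode e) x y Q"
  then show "phi_oracle A e x = Some y"
    unfolding phi_oracle_def
    by (auto intro!: the_equality dest: evalq_deterministic)
next
  assume *: "phi_oracle A e x = Some y"
  then obtain z Q where z: "evalq A (rf_decode e) x z Q"
    by (auto simp: phi_oracle_def split: if_splits)
  then have "(THE y. \<exists>Q. evalq A (rf_decode e) x y Q) = z"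
    by (blast intro: the_equality dest: evalq_deterministic)
  with * z have "y = z" by (auto simp: phi_oracle_def split: if_splits)
  with z show "\<exists>Q. evalq A (rf_decode e) x y Q" by blast
qed

lemma phi_eq_Some: "phi e x = Some y \<longleftrightarrow> (\<exists>Q. evalq {} (rf_decode e) x y Q)"
  by (simp add: phi_def phi_oracle_eq_Some)

lemma phi_neq_None: "phi e x \<noteq> None \<longleftrightarrow> (\<exists>y Q. evalq {} (rf_decode e) x y Q)"
  using phi_eq_Some by auto

lemma rec_enum_term:
  assumes "rec_enum A"
  obtains t where "\<And>x. x \<in> A \<longleftrightarrow> (\<exists>y Q. evalq {} t x y Q)"
  using assms unfolding rec_enum_def phi_neq_None by blast

section \<open>Replacing the oracle by a program\<close>

fun oracle_subst :: "rf \<Rightarrow> rf \<Rightarrow> rf" where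
  "oracle_subst s Orc = s"
| "oracle_subst s (Comp f g) = Comp (oracle_subst s f) (oracle_subst s g)"
| "oracle_subst s (Pair f g) = Pair (oracle_subst s f) (oracle_subst s g)"
| "oracle_subst s (PrimRec f g) = PrimRec (oracle_subst s f) (oracle_subst s g)"
| "oracle_subst s (Mu f) = Mu (oracle_subst s f)"
| "oracle_subst s t = t"

text \<open>Only the queries of this run must be answered correctly by \<open>s\<close>, which may
  err or diverge elsewhere. \<open>R q\<close> collects the queries that \<open>s\<close> itself
  makes on input \<open>q\<close>.\<close>

lemma evalq_oracle_subst:
  assumes "evalq A t x y Q" "\<forall>q\<in>Q. evalq B s q (indic A q) (R q)"
  shows "evalq B (oracle_subst s t) x y (\<Union>q\<in>Q. R q)"
  using assms
proof (induction rule: evalq.induct)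
  case (ev_comp g x y Q1 f z Q2)
  then have "evalq B (oracle_subst s g) x y (\<Union>q\<in>Q1. R q)"
    "evalq B (oracle_subst s f) y z (\<Union>q\<in>Q2. R q)" by auto
  from evalq.ev_comp[OF this] show ?case by simp
next
  case (ev_pair f x y1 Q1 g y2 Q2)
  then have "evalq B (oracle_subst s f) x y1 (\<Union>q\<in>Q1. R q)"
    "evalq B (oracle_subst s g) x y2 (\<Union>q\<in>Q2. R q)" by auto
  from evalq.ev_pair[OF this] show ?case by simp
next
  case (ev_pr0 f a y Q g)
  then show ?case by (simp add: evalq.ev_pr0)
next
  case (ev_prS f g a n y Q1 z Q2)
  then have "evalq B (PrimRec (oracle_subst s f) (oracle_subst s g)) (npair a n) y
      (\<Union>q\<in>Q1. R q)"
    "evalq B (oracle_subst s g) (npair a (npair n y)) z (\<Union>q\<in>Q2. R q)" by auto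
  from evalq.ev_prS[OF this] show ?case by simp
next
  case (ev_mu n f x vs Qs Q)
  have "evalq B (Mu (oracle_subst s f)) x n (\<Union>(R ` Q) \<union> (\<Union>i<n. \<Union>(R ` Qs i)))"
  proof (rule evalq.ev_mu)
    show "\<forall>i<n. evalq B (oracle_subst s f) (npair x i) (Suc (vs i)) (\<Union>(R ` Qs i))"
      using ev_mu by auto
    show "evalq B (oracle_subst s f) (npair x n) 0 (\<Union>(R ` Q))" using ev_mu by auto
  qed
  moreover have "\<Union>(R ` Q) \<union> (\<Union>i<n. \<Union>(R ` Qs i)) = (\<Union>q\<in>Q \<union> (\<Union>i<n. Qs i). R q)"
    by simp
  ultimately show ?case by (simp only: oracle_subst.simps)
next
  case (ev_orc x)
  then show ?case by (simp add: indic_def)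
qed (simp_all add: evalq.ev_zero evalq.ev_succ evalq.ev_ident evalq.ev_fst evalq.ev_snd)

section \<open>Total recursive functions\<close>

text \<open>One program that asks nothing and works for every oracle can serve both as a part of
  some \<open>phi e\<close> and inside a reduction to \<open>A\<close>, where it adds nothing to the
  use.\<close>

definition total_rec :: "(nat \<Rightarrow> nat) \<Rightarrow> bool" where
  "total_rec F \<longleftrightarrow> (\<exists>t. \<forall>A x. evalq A t x (F x) {})"

lemma evalq_Comp_pure:
  "evalq A g x y {} \<Longrightarrow> evalq A f y z Q \<Longrightarrow> evalq A (Comp f g) x z Q"
  using ev_comp[of A g x y "{}" f z Q] by simp

lemma evalq_Pair_pure:
  "evalq A f x y {} \<Longrightarrow> evalq A g x z Q \<Longrightarrow> evalq A (Pair f g) x (npair y z) Q"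
  using ev_pair[of A f x y "{}" g z Q] by simp

lemma evalq_Mu_pure:
  assumes "\<And>n. evalq A f (npair x n) (F n) {}" "F m = 0"
  shows "evalq A (Mu f) x (LEAST n. F n = 0) {}"
proof -
  let ?n = "LEAST n. F n = 0"
  have "evalq A (Mu f) x ?n ({} \<union> (\<Union>i<?n. {}))"
  proof (rule ev_mu)
    \<comment> \<open>\<open>ev_mu\<close> wants values of the form \<open>Suc _\<close> before the
      least zero; \<open>F i\<close> is nonzero there, so \<open>F i - 1\<close> is its true
      predecessor.\<close>
    show "\<forall>i<?n. evalq A f (npair x i) (Suc (F i - 1)) {}"
    proof (intro allI impI)
      fix i assume "i < ?n"
      then have "F i \<noteq> 0" by (rule not_less_Least)
      then show "evalq A f (npair x i) (Suc (F i - 1)) {}" using assms(1)[of i] by simp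
    qed
    have "F ?n = 0" using assms(2) by (rule LeastI)
    then show "evalq A f (npair x ?n) 0 {}" using assms(1)[of ?n] by simp
  qed
  then show ?thesis by simp
qed

text \<open>A run with oracle \<open>{}\<close> receives only the answer 0, so replacing the oracle
  by the program \<open>Zero\<close> keeps the value and removes all queries.\<close>

lemma computable_iff_total_rec: "computable F \<longleftrightarrow> total_rec F"
proof
  assume "computable F"
  then obtain e where e: "\<And>x. \<exists>Q. evalq {} (rf_decode e) x (F x) Q"
    unfolding computable_def phi_eq_Some by blast
  have "evalq A (oracle_subst Zero (rf_decode e)) x (F x) {}" for A x
  proof -
    obtain Q where "evalq {} (rf_decode e) x (F x) Q" using e by blast
    from evalq_oracle_subst[OF this, of A Zero "\<lambda>_. {}"] show ?thesis
      by (simp add: indic_def ev_zero)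
  qed
  then show "total_rec F" unfolding total_rec_def by blast
next
  assume "total_rec F"
  then obtain t where "\<And>x. evalq {} t x (F x) {}" unfolding total_rec_def by blast
  then show "computable F"
    unfolding computable_def phi_eq_Some by (metis rf_decode_encode)
qed

named_theorems total_rec_intros

lemma total_rec_id [total_rec_intros]: "total_rec (\<lambda>x. x)"
  unfolding total_rec_def using ev_ident by blast

lemma total_rec_compose: "total_rec F \<Longrightarrow> total_rec G \<Longrightarrow> total_rec (\<lambda>x. F (G x))"
  unfolding total_rec_def by (meson evalq_Comp_pure)

lemma total_rec_Suc [total_rec_intros]: "total_rec F \<Longrightarrow> total_rec (\<lambda>x. Suc (F x))"
  by (rule total_rec_compose[of Suc]) (use ev_succ in \<open>auto simp: total_rec_def\<close>)

lemma total_rec_const [total_rec_intros]: "total_rec (\<lambda>x. c)"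
proof (induction c)
  case 0
  show ?case unfolding total_rec_def using ev_zero by blast
next
  case (Suc c)
  then show ?case by (rule total_rec_Suc)
qed

lemma total_rec_nfst [total_rec_intros]: "total_rec F \<Longrightarrow> total_rec (\<lambda>x. nfst (F x))"
  by (rule total_rec_compose[of nfst]) (use ev_fst in \<open>auto simp: total_rec_def\<close>)

lemma total_rec_nsnd [total_rec_intros]: "total_rec F \<Longrightarrow> total_rec (\<lambda>x. nsnd (F x))"
  by (rule total_rec_compose[of nsnd]) (use ev_snd in \<open>auto simp: total_rec_def\<close>)

lemma total_rec_npair [total_rec_intros]:
  "total_rec F \<Longrightarrow> total_rec G \<Longrightarrow> total_rec (\<lambda>x. npair (F x) (G x))"
  unfolding total_rec_def by (meson evalq_Pair_pure)

text \<open>The packing of parameter, counter and previous value in the last assumption is the one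
  that \<open>ev_prS\<close> passes to the step program.\<close>

lemma total_rec_rec_nat [total_rec_intros]:
  assumes "total_rec F" "total_rec N"
    and "total_rec (\<lambda>p. g (nfst p) (nfst (nsnd p)) (nsnd (nsnd p)))"
  shows "total_rec (\<lambda>x. rec_nat (F x) (g x) (N x))"
proof -
  obtain f h b where f: "\<And>A x. evalq A f x (F x) {}" and h: "\<And>A x. evalq A h x (N x) {}"
    and b: "\<And>A p. evalq A b p (g (nfst p) (nfst (nsnd p)) (nsnd (nsnd p))) {}"
    using assms unfolding total_rec_def by metis
  have rec: "evalq A (PrimRec f b) (npair x n) (rec_nat (F x) (g x) n) {}" for A x n
  proof (induction n)
    case 0
    show ?case using ev_pr0[OF f] by simp
  next
    case (Suc n)
    have "evalq A b (npair x (npair n (rec_nat (F x) (g x) n)))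
        (rec_nat (F x) (g x) (Suc n)) {}"
      using b[of A "npair x (npair n (rec_nat (F x) (g x) n))"] by simp
    from ev_prS[OF Suc this] show ?case by simp
  qed
  have "evalq A (Comp (PrimRec f b) (Pair Ident h)) x (rec_nat (F x) (g x) (N x)) {}" for A x
    using evalq_Comp_pure[OF evalq_Pair_pure[OF ev_ident h] rec] .
  then show ?thesis unfolding total_rec_def by blast
qed

lemma total_rec_pred [total_rec_intros]:
  assumes "total_rec F" shows "total_rec (\<lambda>x. F x - 1)"
proof -
  have "total_rec (\<lambda>x. rec_nat 0 (\<lambda>n _. n) (F x))" by (intro total_rec_intros assms)
  moreover have "rec_nat 0 (\<lambda>n _. n) m = m - 1" for m :: nat by (cases m) auto
  ultimately show ?thesis by simp
qed

lemma total_rec_add [total_rec_intros]: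
  assumes "total_rec F" "total_rec G" shows "total_rec (\<lambda>x. F x + G x)"
proof -
  have "total_rec (\<lambda>x. rec_nat (F x) (\<lambda>_ y. Suc y) (G x))" by (intro total_rec_intros assms)
  moreover have "rec_nat a (\<lambda>_ y. Suc y) m = a + m" for a m :: nat by (induction m) auto
  ultimately show ?thesis by simp
qed

lemma total_rec_diff [total_rec_intros]:
  assumes "total_rec F" "total_rec G" shows "total_rec (\<lambda>x. F x - G x)"
proof -
  have "total_rec (\<lambda>x. rec_nat (F x) (\<lambda>_ y. y - 1) (G x))" by (intro total_rec_intros assms)
  moreover have "rec_nat a (\<lambda>_ y. y - 1) m = a - m" for a m :: nat by (induction m) auto
  ultimately show ?thesis by simp
qed

lemma total_rec_if_eq [total_rec_intros]:
  assumes "total_rec F" "total_rec G" "total_rec H" "total_rec J"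
  shows "total_rec (\<lambda>x. if F x = G x then H x else J x)"
proof -
  \<comment> \<open>The sum of the two truncated differences is 0 exactly in the case of equality;
    any positive number of rounds yields \<open>J x\<close>.\<close>
  have "total_rec (\<lambda>x. rec_nat (H x) (\<lambda>_ _. J x) ((F x - G x) + (G x - F x)))"
    by (intro total_rec_intros assms total_rec_compose[OF assms(4)])
  moreover have "rec_nat a (\<lambda>_ _. b) ((m - n) + (n - m)) = (if m = n then a else b)"
    for a b m n :: nat by (cases "(m - n) + (n - m)") auto
  ultimately show ?thesis by simp
qed

lemma total_rec_funpow:
  assumes "total_rec f" "total_rec N" "total_rec C"
  shows "total_rec (\<lambda>x. (f ^^ N x) (C x))"
proof -
  have "total_rec (\<lambda>x. rec_nat (C x) (\<lambda>_ y. f y) (N x))"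
    by (intro total_rec_intros assms total_rec_compose[OF assms(1)])
  moreover have "rec_nat c (\<lambda>_ y. f y) n = (f ^^ n) c" for c n by (induction n) auto
  ultimately show ?thesis by simp
qed

text \<open>A count by primitive recursion. It later lets a search compare a stage of
  \<open>A\<close> with the number of elements of \<open>A\<close> below a bound.\<close>

lemma total_rec_card:
  assumes "total_rec (\<lambda>p. indic (S (nfst p)) (nsnd p))" "total_rec B" "total_rec G"
  shows "total_rec (\<lambda>x. card (S (G x) \<inter> {..<B x}))"
proof -
  have "total_rec (\<lambda>p. (\<lambda>x n y. y + indic (S (G x)) n)
      (nfst p) (nfst (nsnd p)) (nsnd (nsnd p)))"
    using total_rec_compose[OF assms(1), of "\<lambda>p. npair (G (nfst p)) (nfst (nsnd p))"]
    by (simp add: total_rec_intros total_rec_compose[OF assms(3)])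
  then have "total_rec (\<lambda>x. rec_nat 0 (\<lambda>n y. y + indic (S (G x)) n) (B x))"
    by (intro total_rec_rec_nat total_rec_const assms(2)) simp
  moreover have "rec_nat 0 (\<lambda>n y. y + indic T n) m = card (T \<inter> {..<m})" for T m
    by (induction m) (auto simp: indic_def lessThan_Suc)
  ultimately show ?thesis by simp
qed

section \<open>From wtt-completeness to weak effective undecidability\<close>

text \<open>The code of \<open>oracle_subst s t\<close> computed from the code of \<open>s\<close>; it is also defined when
  that code is junk.\<close>

fun subst_code :: "rf \<Rightarrow> nat \<Rightarrow> nat" where
  "subst_code Orc c = c"
| "subst_code (Comp f g) c = npair 6 (npair (subst_code f c) (subst_code g c))"
| "subst_code (Pair f g) c = npair 7 (npair (subst_code f c) (subst_code g c))"
| "subst_code (PrimRec f g) c = npair 8 (npair (subst_code f c) (subst_code g c))"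
| "subst_code (Mu f) c = npair 9 (subst_code f c)"
| "subst_code t c = rf_encode t"

lemma subst_code_correct: "subst_code t (rf_encode s) = rf_encode (oracle_subst s t)"
  by (induction t) auto

text \<open>Since \<open>t\<close> is fixed, the function is a finite nest of pairings; no recursion
  over codes is involved.\<close>

lemma total_rec_subst_code: "total_rec (subst_code t)"
  by (induction t) (auto intro!: total_rec_intros)

text \<open>\<open>Mu Fst\<close> on input \<open>y\<close> looks for \<open>i\<close> with first
  component of \<open>npair y i\<close> equal to 0. This does not depend on \<open>i\<close>: the
  search stops at once or never.\<close>

lemma evalq_Comp_Mu_Fst:
  assumes "evalq A t x y Q"
  shows "(\<exists>z R. evalq A (Comp (Mu Fst) t) x z R) \<longleftrightarrow> y = 0"
proof
  assume "\<exists>z R. evalq A (Comp (Mu Fst) t) x z R"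
  then obtain z R y' Q1 where "evalq A t x y' Q1" "evalq A (Mu Fst) y' z R"
    by (metis evalq_CompE)
  moreover have "y' = y" using evalq_deterministic assms calculation(1) by blast
  ultimately have "evalq A (Mu Fst) y z R" by simp
  then show "y = 0" by (rule evalq_MuE) (auto elim: evalq_FstE)
next
  assume "y = 0"
  have "evalq A Fst (npair 0 n) 0 {}" for n using ev_fst[of A "npair 0 n"] by simp
  then have "\<exists>z. evalq A (Mu Fst) 0 z {}" using evalq_Mu_pure[of A Fst 0 "\<lambda>_. 0"] by blast
  with assms \<open>y = 0\<close> show "\<exists>z R. evalq A (Comp (Mu Fst) t) x z R" by (blast intro: ev_comp)
qed

lemma wtt_complete_imp_D_weu:
  assumes "wtt_complete A"
  shows "D_weu A"
proof -
  obtain e0 u where re: "rec_enum A" and u: "computable u"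
    and K: "\<And>x. phi_oracle A e0 x = Some (indic haltK x)"
    and q: "\<And>x. queries_below A e0 x (u x)"
    using assms unfolding wtt_complete_def by blast
  define t where "t = rf_decode e0"
  \<comment> \<open>The tag 6 is that of \<open>Comp\<close>: on the code of \<open>s\<close> this
    gives the code of the program \<open>r\<close> below.\<close>
  define h where "h e = npair 6 (npair (rf_encode (Mu Fst)) (subst_code t e))" for e
  \<comment> \<open>Disagreement includes divergence of \<open>phi\<close> at
    \<open>z\<close>.\<close>
  have disagree: "\<exists>z<u (h (rf_encode s)). phi (rf_encode s) z \<noteq> Some (indic A z)" for s
  proof (rule ccontr)
    assume "\<not> ?thesis"
    then have "\<forall>z. \<exists>R. z < u (h (rf_encode s)) \<longrightarrow> evalq {} s z (indic A z) R"
      by (auto simp: phi_eq_Some)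
    then obtain R where R: "\<And>z. z < u (h (rf_encode s)) \<Longrightarrow> evalq {} s z (indic A z) (R z)"
      by metis
    define x where "x = h (rf_encode s)"
    define r where "r = Comp (Mu Fst) (oracle_subst s t)"
    have dec: "rf_decode x = r"
      using rf_decode_encode[of r] by (simp add: x_def h_def r_def subst_code_correct)
    obtain Q where Q: "evalq A t x (indic haltK x) Q"
      using K[of x] by (auto simp: phi_oracle_eq_Some t_def)
    then have "\<forall>z\<in>Q. z < u x" using q[of x] unfolding queries_below_def t_def by blast
    then have "evalq {} (oracle_subst s t) x (indic haltK x) (\<Union>z\<in>Q. R z)"
      using R by (intro evalq_oracle_subst[OF Q]) (simp add: x_def)
    from evalq_Comp_Mu_Fst[OF this]
    \<comment> \<open>The program with code \<open>x\<close>, run on \<open>x\<close>, halts iff the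
      reduction says that it does not.\<close>
    have "x \<in> haltK \<longleftrightarrow> indic haltK x = 0"
      unfolding haltK_def mem_Collect_eq phi_neq_None dec r_def by simp
    then show False by (auto simp: indic_def split: if_splits)
  qed
  \<comment> \<open>Codes outside the range of \<open>rf_encode\<close> decode to
    \<open>Zero\<close>, so an element of \<open>A\<close> refutes them all. One exists because the
    program \<open>Zero\<close> itself disagrees with \<open>A\<close> somewhere.\<close>
  obtain a where a: "a \<in> A"
  proof -
    obtain z where "phi (rf_encode Zero) z \<noteq> Some (indic A z)" using disagree by blast
    then show ?thesis
      using that ev_zero unfolding phi_eq_Some rf_decode_encode indic_def by (metis (full_types))
  qed
  \<comment> \<open>The summand \<open>Suc a\<close> puts \<open>a\<close> into every
    \<open>f e\<close>.\<close>
  define f where "f e = {..<u (h e) + Suc a}" for e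
  \<comment> \<open>The canonical index of an initial segment of length \<open>n\<close> is
    \<open>2 ^ n - 1\<close>, obtained by iterating \<open>y\<close> to \<open>2 * y + 1\<close>
    from 0.\<close>
  have "Suc (set_encode {..<n}) = 2 ^ n" for n
    by (induction n) (auto simp: set_encode_def lessThan_Suc)
  moreover have "2 ^ n = Suc (rec_nat 0 (\<lambda>_ y. Suc (y + y)) n)" for n
    by (induction n) auto
  ultimately have "set_encode {..<n} = rec_nat 0 (\<lambda>_ y. Suc (y + y)) n" for n
    by (metis Suc_inject)
  moreover have "total_rec (\<lambda>e. rec_nat 0 (\<lambda>_ y. Suc (y + y)) (u (h e) + Suc a))"
    unfolding h_def
    by (intro total_rec_intros total_rec_compose[OF u[unfolded computable_iff_total_rec]]
        total_rec_subst_code)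
  ultimately have "computable_fin f"
    by (simp add: computable_fin_def computable_iff_total_rec f_def)
  moreover have "\<exists>z\<in>f e. phi e z \<noteq> Some (indic A z)" for e
  proof (cases "e \<in> range rf_encode")
    case True
    then obtain s where "e = rf_encode s" by blast
    with disagree[of s] show ?thesis by (auto simp: f_def intro: less_le_trans)
  next
    case False
    then have "phi e a = Some 0" by (auto simp: phi_eq_Some rf_decode_def intro: ev_zero)
    with a show ?thesis by (intro bexI[of _ a]) (auto simp: f_def indic_def)
  qed
  ultimately show ?thesis unfolding D_weu_def using re by blast
qed

section \<open>A universal machine\<close>


text \<open>A machine state pairs a value with a stack of frames. A frame with tag at most 9 is the
  code of a program to be run on the current value; the tags from 10 on mark the frames that
  resume a pairing (10 and 11), a recursion (12) or a minimisation (13). The machine has halted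
  when the stack is empty.\<close>

abbreviation push :: "nat \<Rightarrow> nat \<Rightarrow> nat" where "push e k \<equiv> Suc (npair e k)"

text \<open>Tag 5 returns 0 since only the oracle \<open>{}\<close> is simulated. Besides its tag,
  frame 10 holds the input and the second program, frame 11 the first value, frame 12 the step
  program with parameter and counter, and frame 13 the body with input and index.\<close>

definition machine_step :: "nat \<Rightarrow> nat" where
  "machine_step c =
    (let v = nfst c; k = nsnd c; e = nfst (k - 1); r = nsnd (k - 1); i = nfst e; a = nsnd e in
     if k = 0 then c
     else if i = 0 then npair 0 r
     else if i = 1 then npair (Suc v) r
     else if i = 2 then npair v r
     else if i = 3 then npair (nfst v) r
     else if i = 4 then npair (nsnd v) r
     else if i = 5 then npair 0 r
     else if i = 6 then npair v (push (nsnd a) (push (nfst a) r))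
     else if i = 7 then npair v (push (nfst a) (push (npair 10 (npair v (nsnd a))) r))
     else if i = 8 then
       (if nsnd v = 0 then npair (nfst v) (push (nfst a) r)
        else npair (npair (nfst v) (nsnd v - 1))
          (push e (push (npair 12 (npair (nsnd a) (npair (nfst v) (nsnd v - 1)))) r)))
     else if i = 9 then npair (npair v 0) (push a (push (npair 13 (npair a (npair v 0))) r))
     else if i = 10 then npair (nfst a) (push (nsnd a) (push (npair 11 v) r))
     else if i = 11 then npair (npair a v) r
     else if i = 12 then
       npair (npair (nfst (nsnd a)) (npair (nsnd (nsnd a)) v)) (push (nfst a) r)
     else if v = 0 then npair (nsnd (nsnd a)) r
     else npair (npair (nfst (nsnd a)) (Suc (nsnd (nsnd a))))
       (push (nfst a)
         (push (npair 13 (npair (nfst a) (npair (nfst (nsnd a)) (Suc (nsnd (nsnd a)))))) r)))"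

lemma total_rec_machine_step: "total_rec machine_step"
  unfolding machine_step_def Let_def by (intro total_rec_intros)

definition reaches :: "('a \<Rightarrow> 'a) \<Rightarrow> 'a \<Rightarrow> 'a \<Rightarrow> bool" where
  "reaches f c d \<longleftrightarrow> (\<exists>n. (f ^^ n) c = d)"

lemma reaches_step: "f c = d \<Longrightarrow> reaches f c d"
  unfolding reaches_def by (intro exI[of _ 1]) simp

lemma reaches_trans [trans]:
  assumes "reaches f a b" "reaches f b c" shows "reaches f a c"
proof -
  obtain m n where "(f ^^ m) a = b" "(f ^^ n) b = c"
    using assms unfolding reaches_def by blast
  then have "(f ^^ (n + m)) a = c" by (simp add: funpow_add)
  then show ?thesis unfolding reaches_def by blast
qed

text \<open>The rest \<open>k\<close> of the stack is arbitrary, so that the runs of the subprograms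
  can be chained.\<close>

lemma reaches_eval:
  assumes "evalq {} t x y Q"
  shows "reaches machine_step (npair x (push (rf_encode t) k)) (npair y k)"
  using assms
proof (induction arbitrary: k rule: evalq.induct)
  case (ev_comp g x y Q1 f z Q2)
  have "reaches machine_step (npair x (push (rf_encode (Comp f g)) k))
      (npair x (push (rf_encode g) (push (rf_encode f) k)))"
    by (rule reaches_step) (simp add: machine_step_def Let_def)
  also note ev_comp.IH(1)
  also note ev_comp.IH(2)
  finally show ?case .
next
  case (ev_pair f x y1 Q1 g y2 Q2)
  have "reaches machine_step (npair x (push (rf_encode (Pair f g)) k))
      (npair x (push (rf_encode f) (push (npair 10 (npair x (rf_encode g))) k)))"
    by (rule reaches_step) (simp add: machine_step_def Let_def)
  also note ev_pair.IH(1)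
  also have "reaches machine_step (npair y1 (push (npair 10 (npair x (rf_encode g))) k))
      (npair x (push (rf_encode g) (push (npair 11 y1) k)))"
    by (rule reaches_step) (simp add: machine_step_def Let_def)
  also note ev_pair.IH(2)
  also have "reaches machine_step (npair y2 (push (npair 11 y1) k)) (npair (npair y1 y2) k)"
    by (rule reaches_step) (simp add: machine_step_def Let_def)
  finally show ?case .
next
  case (ev_pr0 f a y Q g)
  have "reaches machine_step (npair (npair a 0) (push (rf_encode (PrimRec f g)) k))
      (npair a (push (rf_encode f) k))"
    by (rule reaches_step) (simp add: machine_step_def Let_def)
  also note ev_pr0.IH
  finally show ?case .
next
  case (ev_prS f g a n y Q1 z Q2)
  have "reaches machine_step (npair (npair a (Suc n)) (push (rf_encode (PrimRec f g)) k))
      (npair (npair a n) (push (rf_encode (PrimRec f g))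
        (push (npair 12 (npair (rf_encode g) (npair a n))) k)))"
    by (rule reaches_step) (simp add: machine_step_def Let_def)
  also note ev_prS.IH(1)
  also have "reaches machine_step (npair y (push (npair 12 (npair (rf_encode g) (npair a n))) k))
      (npair (npair a (npair n y)) (push (rf_encode g) k))"
    by (rule reaches_step) (simp add: machine_step_def Let_def)
  also note ev_prS.IH(2)
  finally show ?case .
next
  case (ev_mu n f x vs Qs Q)
  \<comment> \<open>The state just before the body is tested at index \<open>i\<close>.\<close>
  let ?loop = "\<lambda>i. npair (npair x i)
    (push (rf_encode f) (push (npair 13 (npair (rf_encode f) (npair x i))) k))"
  have "reaches machine_step (npair x (push (rf_encode (Mu f)) k)) (?loop i)" if "i \<le> n" for i
    using that
  proof (induction i)
    case 0
    show ?case by (rule reaches_step) (simp add: machine_step_def Let_def)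
  next
    case (Suc i)
    then have "reaches machine_step (npair x (push (rf_encode (Mu f)) k)) (?loop i)" by simp
    also have "reaches machine_step (?loop i)
        (npair (Suc (vs i)) (push (npair 13 (npair (rf_encode f) (npair x i))) k))"
      using ev_mu.IH(1) Suc.prems by simp
    also have "reaches machine_step \<dots> (?loop (Suc i))"
      by (rule reaches_step) (simp add: machine_step_def Let_def)
    finally show ?case .
  qed
  then have "reaches machine_step (npair x (push (rf_encode (Mu f)) k)) (?loop n)" by simp
  also note ev_mu.IH(2)
  also have "reaches machine_step (npair 0 (push (npair 13 (npair (rf_encode f) (npair x n))) k)) (npair n k)"
    by (rule reaches_step) (simp add: machine_step_def Let_def)
  finally show ?case .
qed (auto intro!: reaches_step simp: machine_step_def Let_def)

section \<open>From halting of the machine back to evaluation\<close>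

definition halts_in :: "nat \<Rightarrow> nat \<Rightarrow> bool" where
  "halts_in n c \<longleftrightarrow> nsnd ((machine_step ^^ n) c) = 0"

lemma halts_in_push:
  assumes "halts_in n (npair v (push e k))" "machine_step (npair v (push e k)) = d"
  obtains m where "n = Suc m" "halts_in m d"
proof (cases n)
  case 0
  with assms(1) show ?thesis by (simp add: halts_in_def)
next
  case (Suc m)
  with assms that show ?thesis by (simp add: halts_in_def funpow_swap1)
qed

text \<open>Induction on the number of steps. The strict decrease \<open>m<n\<close> makes the
  hypothesis applicable to each subprogram in turn, and to \<open>t\<close> itself in a primitive
  recursion.\<close>

lemma halts_in_eval:
  assumes "halts_in n (npair x (push (rf_encode t) k))"
  shows "\<exists>y Q. evalq {} t x y Q \<and> (\<exists>m<n. halts_in m (npair y k))"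
  using assms
proof (induction n arbitrary: t x k rule: less_induct)
  case (less n)
  let ?goal = "\<exists>y Q. evalq {} t x y Q \<and> (\<exists>m<n. halts_in m (npair y k))"
  have basic: ?goal
    if "machine_step (npair x (push (rf_encode t) k)) = npair y k" "evalq {} t x y Q" for y Q
    using halts_in_push[OF less.prems that(1)] that(2) by (metis lessI)
  show ?goal
  proof (cases t)
    case Zero
    then show ?thesis by (intro basic[OF _ ev_zero[folded Zero]]) (simp add: machine_step_def Let_def)
  next
    case Succ
    then show ?thesis by (intro basic[OF _ ev_succ[folded Succ]]) (simp add: machine_step_def Let_def)
  next
    case Ident
    then show ?thesis by (intro basic[OF _ ev_ident[folded Ident]]) (simp add: machine_step_def Let_def)
  next
    case Fst
    then show ?thesis by (intro basic[OF _ ev_fst[folded Fst]]) (simp add: machine_step_def Let_def)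
  next
    case Snd
    then show ?thesis by (intro basic[OF _ ev_snd[folded Snd]]) (simp add: machine_step_def Let_def)
  next
    case Orc
    then show ?thesis by (intro basic[OF _ ev_orc[folded Orc]]) (simp add: machine_step_def Let_def)
  next
    case (Comp f g)
    have "machine_step (npair x (push (rf_encode t) k))
        = npair x (push (rf_encode g) (push (rf_encode f) k))"
      by (simp add: machine_step_def Let_def Comp)
    from halts_in_push[OF less.prems this] obtain m where m: "n = Suc m"
      "halts_in m (npair x (push (rf_encode g) (push (rf_encode f) k)))" .
    obtain y Q1 m1 where 1: "evalq {} g x y Q1" "m1 < m"
      "halts_in m1 (npair y (push (rf_encode f) k))"
      using less.IH[OF _ m(2)] m(1) by auto
    obtain z Q2 m2 where 2: "evalq {} f y z Q2" "m2 < m1" "halts_in m2 (npair z k)"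
      using less.IH[OF _ 1(3)] m(1) 1(2) by auto
    have "m2 < n" using m(1) 1(2) 2(2) by simp
    with ev_comp[OF 1(1) 2(1)] 2(3) Comp show ?thesis by blast
  next
    case (Pair f g)
    have "machine_step (npair x (push (rf_encode t) k))
        = npair x (push (rf_encode f) (push (npair 10 (npair x (rf_encode g))) k))"
      by (simp add: machine_step_def Let_def Pair)
    from halts_in_push[OF less.prems this] obtain m where m: "n = Suc m"
      "halts_in m (npair x (push (rf_encode f) (push (npair 10 (npair x (rf_encode g))) k)))" .
    obtain y Q1 m1 where 1: "evalq {} f x y Q1" "m1 < m"
      "halts_in m1 (npair y (push (npair 10 (npair x (rf_encode g))) k))"
      using less.IH[OF _ m(2)] m(1) by auto
    obtain m2 where 2: "m1 = Suc m2"
      "halts_in m2 (npair x (push (rf_encode g) (push (npair 11 y) k)))"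
      using 1(3) by (rule halts_in_push) (auto simp: machine_step_def Let_def)
    obtain z Q2 m3 where 3: "evalq {} g x z Q2" "m3 < m2"
      "halts_in m3 (npair z (push (npair 11 y) k))"
      using less.IH[OF _ 2(2)] m(1) 1(2) 2(1) by auto
    obtain m4 where 4: "m3 = Suc m4" "halts_in m4 (npair (npair y z) k)"
      using 3(3) by (rule halts_in_push) (auto simp: machine_step_def Let_def)
    have "m4 < n" using m(1) 1(2) 2(1) 3(2) 4(1) by simp
    with ev_pair[OF 1(1) 3(1)] 4(2) Pair show ?thesis by blast
  next
    case (PrimRec f g)
    obtain a j where x: "x = npair a j" by (metis prod.collapse prod_decode_inverse)
    show ?thesis
    proof (cases j)
      case 0
      have "machine_step (npair x (push (rf_encode t) k)) = npair a (push (rf_encode f) k)"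
        by (simp add: machine_step_def Let_def PrimRec x 0)
      from halts_in_push[OF less.prems this] obtain m where m: "n = Suc m"
        "halts_in m (npair a (push (rf_encode f) k))" .
      obtain y Q m1 where 1: "evalq {} f a y Q" "m1 < m" "halts_in m1 (npair y k)"
        using less.IH[OF _ m(2)] m(1) by auto
      have "m1 < n" using m(1) 1(2) by simp
      with ev_pr0[OF 1(1)] 1(3) PrimRec x 0 show ?thesis by blast
    next
      case (Suc i)
      have "machine_step (npair x (push (rf_encode t) k))
          = npair (npair a i)
            (push (rf_encode t) (push (npair 12 (npair (rf_encode g) (npair a i))) k))"
        by (simp add: machine_step_def Let_def PrimRec x Suc)
      from halts_in_push[OF less.prems this] obtain m where m: "n = Suc m"
        "halts_in m (npair (npair a i)
          (push (rf_encode t) (push (npair 12 (npair (rf_encode g) (npair a i))) k)))" .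
      obtain y Q1 m1 where 1: "evalq {} t (npair a i) y Q1" "m1 < m"
        "halts_in m1 (npair y (push (npair 12 (npair (rf_encode g) (npair a i))) k))"
        using less.IH[OF _ m(2)] m(1) by auto
      obtain m2 where 2: "m1 = Suc m2"
        "halts_in m2 (npair (npair a (npair i y)) (push (rf_encode g) k))"
        using 1(3) by (rule halts_in_push) (auto simp: machine_step_def Let_def)
      obtain z Q2 m3 where 3: "evalq {} g (npair a (npair i y)) z Q2" "m3 < m2"
        "halts_in m3 (npair z k)"
        using less.IH[OF _ 2(2)] m(1) 1(2) 2(1) by auto
      have "m3 < n" using m(1) 1(2) 2(1) 3(2) by simp
      with ev_prS[OF 1(1)[unfolded PrimRec] 3(1)] 3(3) PrimRec x Suc show ?thesis by blast
    qed
  next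
    case (Mu f)
    let ?loop = "\<lambda>i. npair (npair x i)
      (push (rf_encode f) (push (npair 13 (npair (rf_encode f) (npair x i))) k))"
    note IH = less.IH
    \<comment> \<open>The outer hypothesis handles the body; an inner induction on the remaining
      steps collects the positive values that \<open>ev_mu\<close> needs.\<close>
    have loop: ?goal
      if "m < n" "halts_in m (?loop i)" "\<forall>j<i. evalq {} f (npair x j) (Suc (vs j)) (Qs j)"
      for m i vs Qs
      using that
    proof (induction m arbitrary: i vs Qs rule: less_induct)
      case (less m)
      obtain y Q m1 where 1: "evalq {} f (npair x i) y Q" "m1 < m"
        "halts_in m1 (npair y (push (npair 13 (npair (rf_encode f) (npair x i))) k))"
        using IH[OF less.prems(1,2)] by blast
      show ?goal
      proof (cases y)
        case 0
        obtain m2 where 2: "m1 = Suc m2" "halts_in m2 (npair i k)"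
          using 1(3) unfolding 0 by (rule halts_in_push) (auto simp: machine_step_def Let_def)
        have "evalq {} t x i (Q \<union> (\<Union>j<i. Qs j))"
          using ev_mu[OF less.prems(3)] 1(1) Mu 0 by blast
        moreover have "m2 < n" using 1(2) 2(1) less.prems(1) by simp
        ultimately show ?thesis using 2(2) by blast
      next
        case (Suc v)
        obtain m2 where 2: "m1 = Suc m2" "halts_in m2 (?loop (Suc i))"
          using 1(3) unfolding Suc by (rule halts_in_push) (auto simp: machine_step_def Let_def)
        have "\<forall>j<Suc i. evalq {} f (npair x j) (Suc ((vs(i := v)) j)) ((Qs(i := Q)) j)"
          using less.prems(3) 1(1) Suc by (auto simp: less_Suc_eq)
        with 2 1(2) less.prems(1) show ?thesis by (intro less.IH[of m2 "Suc i"]) auto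
      qed
    qed
    have "machine_step (npair x (push (rf_encode t) k)) = ?loop 0"
      by (simp add: machine_step_def Let_def Mu)
    from halts_in_push[OF less.prems this] obtain m where "n = Suc m" "halts_in m (?loop 0)" .
    then show ?thesis by (intro loop[of m 0]) auto
  qed
qed

text \<open>States with empty stack are fixed points of the machine.\<close>

lemma halts_in_mono:
  assumes "halts_in m c" "m \<le> n"
  shows "halts_in n c"
proof -
  have "(machine_step ^^ j) d = d" if "nsnd d = 0" for j d
    using that by (induction j) (simp_all add: machine_step_def)
  moreover have "(machine_step ^^ n) c = (machine_step ^^ (n - m)) ((machine_step ^^ m) c)"
    using assms(2) by (metis comp_apply funpow_add le_add_diff_inverse2)
  ultimately show ?thesis using assms(1) by (simp add: halts_in_def)
qed

lemma ex_halts_in_iff: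
  "(\<exists>n. halts_in n (npair x (push (rf_encode t) 0))) \<longleftrightarrow> (\<exists>y Q. evalq {} t x y Q)"
proof
  assume "\<exists>y Q. evalq {} t x y Q"
  then obtain y where "reaches machine_step (npair x (push (rf_encode t) 0)) (npair y 0)"
    using reaches_eval by blast
  then obtain n where "(machine_step ^^ n) (npair x (push (rf_encode t) 0)) = npair y 0"
    unfolding reaches_def by blast
  then show "\<exists>n. halts_in n (npair x (push (rf_encode t) 0))"
    by (intro exI[of _ n]) (simp add: halts_in_def)
qed (use halts_in_eval in blast)

section \<open>Rejecting invalid codes\<close>

text \<open>Since \<open>rf_decode\<close> sends junk to \<open>Zero\<close>, invalid codes belong to \<open>haltK\<close> and have to be
  enumerated too. The state is \<open>Suc\<close> of a stack of codes still to be checked, or 0 once one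
  of them has been rejected.\<close>

definition check_step :: "nat \<Rightarrow> nat" where
  "check_step c =
    (let k = c - 1; e = nfst (k - 1); r = nsnd (k - 1); i = nfst e; a = nsnd e in
     if c = 0 then 0
     else if k = 0 then c
     else if i - 5 = 0 then (if a = 0 then Suc r else 0)
     else if i - 8 = 0 then Suc (push (nfst a) (push (nsnd a) r))
     else if i = 9 then Suc (push a r)
     else 0)"

text \<open>The closure rules offer equality tests only; this is why \<open>check_step\<close>
  writes \<open>i - 5 = 0\<close> for \<open>i \<le> 5\<close>.\<close>

lemma total_rec_check_step: "total_rec check_step"
  unfolding check_step_def Let_def by (intro total_rec_intros)

definition rejected_in :: "nat \<Rightarrow> nat \<Rightarrow> bool" where
  "rejected_in n e \<longleftrightarrow> (check_step ^^ n) (Suc (push e 0)) = 0"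

text \<open>The two final states: 0 is rejection, \<open>Suc 0\<close> (nothing left to check) is
  acceptance.\<close>

lemma check_step_fixed: "(check_step ^^ n) 0 = 0" "(check_step ^^ n) (Suc 0) = Suc 0"
  by (induction n) (simp_all add: check_step_def)

lemma rejected_in_mono:
  assumes "rejected_in m e" "m \<le> n"
  shows "rejected_in n e"
proof -
  have "(check_step ^^ n) c = (check_step ^^ (n - m)) ((check_step ^^ m) c)" for c
    using assms(2) by (metis comp_apply funpow_add le_add_diff_inverse2)
  then show ?thesis using assms(1) by (simp add: rejected_in_def check_step_fixed)
qed

text \<open>The grammar of valid codes, with the same case split as
  \<open>check_step\<close>.\<close>

lemma npair_in_range_rf_encode:
  "npair i a \<in> range rf_encode \<longleftrightarrow>
    (if i \<le> 5 then a = 0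
     else if i \<le> 8 then nfst a \<in> range rf_encode \<and> nsnd a \<in> range rf_encode
     else i = 9 \<and> a \<in> range rf_encode)" (is "?lhs \<longleftrightarrow> ?rhs")
proof
  assume ?lhs
  then obtain t where "npair i a = rf_encode t" by blast
  then show ?rhs by (cases t) auto
next
  assume rhs: ?rhs
  then have "i \<le> 9" by (simp split: if_splits)
  then consider "i \<le> 5" | "i = 6 \<or> i = 7 \<or> i = 8" | "i = 9" by linarith
  then show ?lhs
  proof cases
    case 1
    then have "i \<in> {0, 1, 2, 3, 4, 5}" "a = 0" using rhs by auto
    then have "npair i a \<in> {rf_encode Zero, rf_encode Succ, rf_encode Ident, rf_encode Fst,
        rf_encode Snd, rf_encode Orc}"
      by auto
    then show ?thesis by blast
  next
    case 2
    then obtain f g where "nfst a = rf_encode f" "nsnd a = rf_encode g" using rhs by auto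
    then have "a = npair (rf_encode f) (rf_encode g)" by (metis prod.collapse prod_decode_inverse)
    with 2 have "npair i a \<in> {rf_encode (Comp f g), rf_encode (Pair f g), rf_encode (PrimRec f g)}"
      by auto
    then show ?thesis by blast
  next
    case 3
    then have "a \<in> range rf_encode" using rhs by simp
    then obtain f where "a = rf_encode f" by blast
    then have "npair i a = rf_encode (Mu f)" by (simp only: 3 rf_encode.simps)
    then show ?thesis by blast
  qed
qed

lemma reaches_check:
  "reaches check_step (Suc (push e k)) (if e \<in> range rf_encode then Suc k else 0)"
proof (induction e arbitrary: k rule: less_induct)
  case (less e)
  obtain i a where e: "e = npair i a" by (metis prod.collapse prod_decode_inverse)
  \<comment> \<open>A positive tag makes the pair strictly larger than \<open>a\<close>; with tag 0
    this fails at \<open>a = 0\<close>.\<close>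
  have a_less: "a < e" if "i > 5"
    using that by (cases "i + a") (simp_all add: e prod_encode_def)
  consider "i \<le> 5" | "5 < i" "i \<le> 8" | "i = 9" | "i > 9" by linarith
  then show ?case
  proof cases
    case 1
    then show ?thesis
      by (intro reaches_step) (simp add: e npair_in_range_rf_encode check_step_def)
  next
    case 2
    obtain b c where a: "a = npair b c" by (metis prod.collapse prod_decode_inverse)
    have bc: "b < e" "c < e"
      using a_less 2 le_prod_encode_1[of b c] le_prod_encode_2[of c b] by (simp_all add: a)
    have start: "reaches check_step (Suc (push e k)) (Suc (push b (push c k)))"
      using 2 by (intro reaches_step) (simp add: e a check_step_def)
    show ?thesis
    proof (cases "b \<in> range rf_encode")
      case True
      with less.IH[OF bc(1), of "push c k"]
      have "reaches check_step (Suc (push b (push c k))) (Suc (push c k))" by simp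
      from reaches_trans[OF start reaches_trans[OF this less.IH[OF bc(2)]]] True 2
      show ?thesis by (simp add: e a npair_in_range_rf_encode)
    next
      case False
      with less.IH[OF bc(1), of "push c k"]
      have "reaches check_step (Suc (push b (push c k))) 0" by simp
      from reaches_trans[OF start this] False 2
      show ?thesis by (simp add: e a npair_in_range_rf_encode)
    qed
  next
    case 3
    have "reaches check_step (Suc (push e k)) (Suc (push a k))"
      using 3 by (intro reaches_step) (simp add: e check_step_def)
    from reaches_trans[OF this less.IH[OF a_less]] 3
    show ?thesis by (simp add: e npair_in_range_rf_encode)
  next
    case 4
    then show ?thesis
      by (intro reaches_step) (simp add: e npair_in_range_rf_encode check_step_def)
  qed
qed

lemma ex_rejected_in_iff: "(\<exists>n. rejected_in n e) \<longleftrightarrow> e \<notin> range rf_encode"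
proof
  assume "\<exists>n. rejected_in n e"
  then obtain m where m: "rejected_in m e" by blast
  show "e \<notin> range rf_encode"
  proof
    assume "e \<in> range rf_encode"
    then obtain n where n: "(check_step ^^ n) (Suc (push e 0)) = Suc 0"
      using reaches_check[of e 0] by (auto simp: reaches_def)
    have "(check_step ^^ (m + n)) (Suc (push e 0)) = Suc 0"
      by (simp add: funpow_add n check_step_fixed)
    moreover have "rejected_in (m + n) e" using m by (rule rejected_in_mono) simp
    ultimately show False by (simp add: rejected_in_def)
  qed
next
  assume "e \<notin> range rf_encode"
  then show "\<exists>n. rejected_in n e"
    using reaches_check[of e 0] by (simp add: reaches_def rejected_in_def)
qed

section \<open>Stages of recursively enumerable sets\<close>

text \<open>Increasing, uniformly decidable approximations; the argument pairs a stage with a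
  candidate element.\<close>

definition recursive_stages :: "(nat \<Rightarrow> nat set) \<Rightarrow> bool" where
  "recursive_stages S \<longleftrightarrow> mono S \<and> total_rec (\<lambda>p. indic (S (nfst p)) (nsnd p))"

lemma recursive_stagesD:
  assumes "recursive_stages S" "total_rec N" "total_rec F"
  shows "total_rec (\<lambda>x. indic (S (N x)) (F x))"
  using total_rec_compose[of "\<lambda>p. indic (S (nfst p)) (nsnd p)" "\<lambda>x. npair (N x) (F x)"] assms
  by (simp add: recursive_stages_def total_rec_npair)

lemma rec_enum_stages:
  assumes "rec_enum A"
  shows "\<exists>S. recursive_stages S \<and> (\<forall>x. x \<in> A \<longleftrightarrow> (\<exists>n. x \<in> S n))"
proof -
  obtain t where t: "\<And>x. x \<in> A \<longleftrightarrow> (\<exists>y Q. evalq {} t x y Q)"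
    using assms by (rule rec_enum_term) blast
  define S where "S n = {x. halts_in n (npair x (push (rf_encode t) 0))}" for n
  have "total_rec (\<lambda>p. if nsnd ((machine_step ^^ nfst p) (npair (nsnd p) (push (rf_encode t) 0))) = 0
      then 1 else 0)"
    by (intro total_rec_intros total_rec_funpow total_rec_machine_step)
  moreover have "mono S" by (auto intro!: monoI simp: S_def halts_in_mono)
  ultimately have "recursive_stages S"
    by (simp add: recursive_stages_def S_def indic_def halts_in_def)
  moreover have "x \<in> A \<longleftrightarrow> (\<exists>n. x \<in> S n)" for x
    using t by (simp add: S_def ex_halts_in_iff)
  ultimately show ?thesis by blast
qed

lemma haltK_stages: "\<exists>S. recursive_stages S \<and> (\<forall>x. x \<in> haltK \<longleftrightarrow> (\<exists>n. x \<in> S n))"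
proof -
  \<comment> \<open>The machine may behave arbitrarily on an invalid code, but this does no harm:
    such codes all lie in \<open>haltK\<close> and are eventually rejected.\<close>
  define S where "S n = {x. halts_in n (npair x (push x 0)) \<or> rejected_in n x}" for n
  have "total_rec (\<lambda>p.
      if nsnd ((machine_step ^^ nfst p) (npair (nsnd p) (push (nsnd p) 0))) = 0 then 1
      else if (check_step ^^ nfst p) (Suc (push (nsnd p) 0)) = 0 then 1 else 0)"
    by (intro total_rec_intros total_rec_funpow total_rec_machine_step total_rec_check_step)
  moreover have "mono S"
    by (auto intro!: monoI simp: S_def intro: halts_in_mono rejected_in_mono)
  moreover have "indic (S n) x =
      (if nsnd ((machine_step ^^ n) (npair x (push x 0))) = 0 then 1
       else if (check_step ^^ n) (Suc (push x 0)) = 0 then 1 else 0)" for n x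
    by (simp add: S_def indic_def halts_in_def rejected_in_def)
  ultimately have "recursive_stages S" by (simp add: recursive_stages_def)
  moreover have "x \<in> haltK \<longleftrightarrow> (\<exists>n. x \<in> S n)" for x
  proof (cases "x \<in> range rf_encode")
    case True
    then obtain t where "x = rf_encode t" by blast
    moreover have "\<not> rejected_in n x" for n using ex_rejected_in_iff True by blast
    ultimately show ?thesis
      using ex_halts_in_iff[of x t] unfolding haltK_def mem_Collect_eq phi_neq_None
      by (simp add: S_def)
  next
    case False
    then have "x \<in> haltK"
      unfolding haltK_def mem_Collect_eq phi_neq_None by (auto simp: rf_decode_def intro: ev_zero)
    moreover have "\<exists>n. x \<in> S n" using False ex_rejected_in_iff[of x] by (auto simp: S_def)
    ultimately show ?thesis by simp
  qed
  ultimately show ?thesis by blast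
qed

section \<open>From weak effective undecidability to wtt-completeness\<close>

text \<open>Constant programs that hard-wire a parameter into a program, in the manner of the s-m-n
  theorem.\<close>

fun numeral_term :: "nat \<Rightarrow> rf" where
  "numeral_term 0 = Zero"
| "numeral_term (Suc n) = Comp Succ (numeral_term n)"

lemma evalq_numeral_term: "evalq A (numeral_term n) x n {}"
proof (induction n)
  case (Suc n)
  then show ?case using evalq_Comp_pure[OF Suc ev_succ] by simp
qed (simp add: ev_zero)

lemma total_rec_numeral_code: "total_rec (\<lambda>x. rf_encode (numeral_term x))"
proof -
  have "total_rec (\<lambda>x. rec_nat (rf_encode Zero) (\<lambda>_ y. npair 6 (npair (rf_encode Succ) y)) x)"
    by (intro total_rec_intros)
  moreover have "rec_nat (rf_encode Zero) (\<lambda>_ y. npair 6 (npair (rf_encode Succ) y)) n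
      = rf_encode (numeral_term n)" for n
    by (induction n) simp_all
  ultimately show ?thesis by simp
qed

lemma D_weu_imp_wtt_complete:
  assumes "D_weu A"
  shows "wtt_complete A"
proof -
  obtain f where re: "rec_enum A" and fin: "\<And>e. finite (f e)"
    and f: "total_rec (\<lambda>e. set_encode (f e))"
    and weu: "\<And>e. \<forall>z\<in>f e. phi e z \<noteq> None \<Longrightarrow> \<exists>z\<in>f e. phi e z \<noteq> Some (indic A z)"
    using assms unfolding D_weu_def computable_fin_def computable_iff_total_rec by blast
  obtain S where S: "recursive_stages S" and in_A: "\<And>x. x \<in> A \<longleftrightarrow> (\<exists>n. x \<in> S n)"
    using rec_enum_stages[OF re] by blast
  obtain H where H: "recursive_stages H" and in_haltK: "\<And>x. x \<in> haltK \<longleftrightarrow> (\<exists>n. x \<in> H n)"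
    using haltK_stages by blast
  have S_mono: "S m \<subseteq> S n" and H_mono: "H m \<subseteq> H n" if "m \<le> n" for m n
    using S H that by (auto simp: recursive_stages_def dest: monoD)

  \<comment> \<open>The value is 0 iff the element has entered, so \<open>Mu wait\<close> finds the
    stage at which \<open>x\<close> enters \<open>haltK\<close>.\<close>
  obtain wait where wait: "\<And>B p. evalq B wait p (1 - indic (H (nsnd p)) (nfst p)) {}"
  proof -
    have "total_rec (\<lambda>p. 1 - indic (H (nsnd p)) (nfst p))"
      by (intro total_rec_intros recursive_stagesD[OF H])
    then show ?thesis using that unfolding total_rec_def by blast
  qed
  obtain look where look: "\<And>B p. evalq B look p (indic (S (nfst p)) (nsnd p)) {}"
    using S unfolding recursive_stages_def total_rec_def by blast
  \<comment> \<open>On input \<open>z\<close> the entry stage of \<open>x\<close> is paired with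
    \<open>z\<close> and handed to \<open>look\<close>.\<close>
  define G where "G x = Comp look (Pair (Comp (Mu wait) (numeral_term x)) Ident)" for x
  define g where "g x = rf_encode (G x)" for x
  have g: "total_rec g"
  proof -
    have "total_rec (\<lambda>x. rf_encode (G x))"
      unfolding G_def rf_encode.simps by (intro total_rec_intros total_rec_numeral_code)
    then show ?thesis by (simp add: g_def[abs_def])
  qed
  have phi_g: "\<exists>n. x \<in> H n \<and> (\<forall>z. phi (g x) z = Some (indic (S n) z))"
    if "x \<in> haltK" for x
  proof -
    define n where "n = (LEAST n. 1 - indic (H n) x = 0)"
    from that obtain n0 where n0: "x \<in> H n0" unfolding in_haltK by blast
    have eq: "1 - indic (H m) x = 0 \<longleftrightarrow> x \<in> H m" for m by (simp add: indic_def)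
    have "evalq {} (G x) z (indic (S n) z) {}" for z
    proof -
      have "evalq {} (Mu wait) x n {}"
        unfolding n_def
      proof (rule evalq_Mu_pure)
        show "evalq {} wait (npair x m) (1 - indic (H m) x) {}" for m
          using wait[of "{}" "npair x m"] by simp
        show "1 - indic (H n0) x = 0" using n0 eq by blast
      qed
      from evalq_Comp_pure[OF evalq_Pair_pure[OF evalq_Comp_pure[OF evalq_numeral_term this] ev_ident] look]
      show ?thesis unfolding G_def by simp
    qed
    then have "\<forall>z. phi (g x) z = Some (indic (S n) z)" unfolding phi_eq_Some g_def by auto
    moreover have "x \<in> H n" using n0 unfolding n_def eq by (rule LeastI)
    ultimately show ?thesis by blast
  qed

  \<comment> \<open>A canonical index is a sum of powers \<open>2 ^ z\<close>, hence exceeds every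
    element \<open>z\<close> of the set.\<close>
  define b where "b x = set_encode (f (g x))" for x
  have b: "total_rec b"
    unfolding b_def using total_rec_compose[OF f g] .
  have below_b: "z < b x" if "z \<in> f (g x)" for x z
  proof -
    have "z < 2 ^ z" by simp
    also have "\<dots> \<le> b x"
      unfolding b_def set_encode_def using fin that by (intro member_le_sum) auto
    finally show ?thesis .
  qed
  have settled: "x \<in> H n" if "x \<in> haltK" "A \<inter> {..<b x} \<subseteq> S n" for x n
  proof -
    obtain m where m: "x \<in> H m" "\<And>z. phi (g x) z = Some (indic (S m) z)"
      using phi_g[OF \<open>x \<in> haltK\<close>] by blast
    obtain z where z: "z \<in> f (g x)" "indic (S m) z \<noteq> indic A z" using weu[of "g x"] m(2) by auto
    \<comment> \<open>The point \<open>z\<close> lies in \<open>A\<close> but not in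
      \<open>S m\<close>. As \<open>z < b x\<close>, it is already in \<open>S n\<close>, so
      \<open>n \<le> m\<close> would put it into \<open>S m\<close>.\<close>
    have "\<not> n \<le> m"
      using S_mono[of n m] in_A that(2) below_b[OF z(1)] z(2)
      by (auto simp: indic_def split: if_splits)
    with m(1) H_mono[of m n] show ?thesis by auto
  qed

  obtain add where add: "\<And>B p. evalq B add p (nfst p + nsnd p) {}"
  proof -
    have "total_rec (\<lambda>p. nfst p + nsnd p)" by (intro total_rec_intros)
    then show ?thesis using that unfolding total_rec_def by blast
  qed
  \<comment> \<open>In the step program, \<open>Comp Snd Snd\<close> is the count so far and
    \<open>Comp Fst Snd\<close> the next number to query. All queries of \<open>\<Gamma>\<close>
    come from here.\<close>
  define count where
    "count = PrimRec Zero (Comp add (Pair (Comp Snd Snd) (Comp Orc (Comp Fst Snd))))"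
  have count: "evalq A count (npair x n) (card (A \<inter> {..<n})) {..<n}" for x n
  proof (induction n)
    case 0
    show ?case unfolding count_def using ev_pr0[OF ev_zero] by simp
  next
    case (Suc n)
    let ?c = "card (A \<inter> {..<n})" and ?p = "npair x (npair n (card (A \<inter> {..<n})))"
    have "evalq A (Comp Snd Snd) ?p ?c {}"
      using evalq_Comp_pure[OF ev_snd ev_snd, of A ?p] by simp
    moreover have "evalq A (Comp Orc (Comp Fst Snd)) ?p (indic A n) {n}"
      using evalq_Comp_pure[OF evalq_Comp_pure[OF ev_snd ev_fst, of A ?p] ev_orc]
      by (simp add: indic_def)
    ultimately have "evalq A (Pair (Comp Snd Snd) (Comp Orc (Comp Fst Snd))) ?p
        (npair ?c (indic A n)) {n}"
      by (rule evalq_Pair_pure)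
    from ev_prS[OF Suc[unfolded count_def] ev_comp[OF this add]]
    have "evalq A count (npair x (Suc n)) (?c + indic A n) (insert n {..<n})"
      by (simp add: count_def)
    moreover have "?c + indic A n = card (A \<inter> {..<Suc n})" by (simp add: indic_def lessThan_Suc)
    ultimately show ?case by (simp add: lessThan_Suc)
  qed
  obtain bound where bound: "\<And>B x. evalq B bound x (b x) {}"
    using b unfolding total_rec_def by blast
  \<comment> \<open>Truncated subtraction: the result is 0 iff stage \<open>nsnd p\<close> contains all of \<open>A\<close> below
    the bound.\<close>
  obtain search where search: "\<And>B p. evalq B search p
      (nsnd (nfst p) - card (S (nsnd p) \<inter> {..<b (nfst (nfst p))})) {}"
  proof -
    have "total_rec (\<lambda>p. nsnd (nfst p) - card (S (nsnd p) \<inter> {..<b (nfst (nfst p))}))"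
      using S unfolding recursive_stages_def
      by (intro total_rec_intros total_rec_card total_rec_compose[OF b]) auto
    then show ?thesis using that unfolding total_rec_def by blast
  qed
  obtain decide where decide: "\<And>B p. evalq B decide p (indic (H (nsnd p)) (nfst p)) {}"
  proof -
    have "total_rec (\<lambda>p. indic (H (nsnd p)) (nfst p))"
      by (intro total_rec_intros recursive_stagesD[OF H])
    then show ?thesis using that unfolding total_rec_def by blast
  qed
  define \<Gamma> where
    "\<Gamma> = Comp decide (Pair Ident (Comp (Mu search) (Pair Ident (Comp count (Pair Ident bound)))))"
  have \<Gamma>: "evalq A \<Gamma> x (indic haltK x) {..<b x}" for x
  proof -
    let ?c = "card (A \<inter> {..<b x})"
    let ?F = "\<lambda>n. ?c - card (S n \<inter> {..<b x})"
    define n where "n = (LEAST n. ?F n = 0)"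
    \<comment> \<open>Each stage is a subset of \<open>A\<close>, so comparing cardinalities below
      the bound suffices.\<close>
    have zero: "?F n = 0 \<longleftrightarrow> A \<inter> {..<b x} \<subseteq> S n" for n
    proof
      assume "?F n = 0"
      moreover have "S n \<inter> {..<b x} \<subseteq> A \<inter> {..<b x}" by (auto simp: in_A)
      ultimately have "S n \<inter> {..<b x} = A \<inter> {..<b x}" by (intro card_seteq) auto
      then show "A \<inter> {..<b x} \<subseteq> S n" by blast
    next
      assume "A \<inter> {..<b x} \<subseteq> S n"
      then show "?F n = 0" by (simp add: card_mono)
    qed
    \<comment> \<open>Only finitely many elements are concerned, and the latest of their entry
      stages works for all.\<close>
    have "\<exists>m. A \<inter> {..<b x} \<subseteq> S m"
    proof -
      have "\<forall>z\<in>A. \<exists>m. z \<in> S m" by (auto simp: in_A)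
      then obtain s where s: "\<And>z. z \<in> A \<Longrightarrow> z \<in> S (s z)" by metis
      have "s z \<le> Max (s ` (A \<inter> {..<b x}))" if "z \<in> A \<inter> {..<b x}" for z using that by simp
      with s S_mono show ?thesis by blast
    qed
    then obtain m where m: "?F m = 0" using zero by blast
    then have "A \<inter> {..<b x} \<subseteq> S n" unfolding zero[symmetric] n_def by (rule LeastI)
    then have "indic (H n) x = indic haltK x"
      using settled[of x n] in_haltK by (auto simp: indic_def)
    moreover have "evalq A (Mu search) (npair x ?c) n {}"
      unfolding n_def
    proof (rule evalq_Mu_pure)
      show "evalq A search (npair (npair x ?c) j) (?F j) {}" for j
        using search[of A "npair (npair x ?c) j"] by simp
      show "?F m = 0" by (rule m)
    qed
    moreover have "evalq A (Comp count (Pair Ident bound)) x ?c {..<b x}"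
      using evalq_Comp_pure[OF evalq_Pair_pure[OF ev_ident bound] count] .
    from evalq_Pair_pure[OF ev_ident this]
    have "evalq A (Pair Ident (Comp count (Pair Ident bound))) x (npair x ?c) {..<b x}" .
    ultimately have "evalq A (Comp (Mu search) (Pair Ident (Comp count (Pair Ident bound)))) x n {..<b x}"
      using ev_comp by fastforce
    from ev_comp[OF evalq_Pair_pure[OF ev_ident this] decide]
    show ?thesis using \<open>indic (H n) x = indic haltK x\<close> by (simp add: \<Gamma>_def)
  qed
  have "phi_oracle A (rf_encode \<Gamma>) x = Some (indic haltK x)" for x
    using \<Gamma> by (auto simp: phi_oracle_eq_Some)
  \<comment> \<open>By determinism every run on \<open>x\<close> has the query set
    \<open>{..<b x}\<close>.\<close>
  moreover have "queries_below A (rf_encode \<Gamma>) x (b x)" for x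
    using evalq_deterministic[OF \<Gamma>[of x]] by (auto simp: queries_below_def)
  ultimately show ?thesis
    unfolding wtt_complete_def computable_iff_total_rec using re b by blast
qed

theorem mainTheorem11:
  fixes A :: "nat set"
  shows "D_weu A \<longleftrightarrow> wtt_complete A"
  using D_weu_imp_wtt_complete wtt_complete_imp_D_weu by blast

end
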